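(* Let $\mathbb{K}$ be a field of characteristic $0$ and $n\ge 5$. Every $n$-dimensional nilpotent Lie algebra over $\mathbb{K}$ of breadth $3$ and characteristic sequence $(4,1,\dots,1)$ is isomorphic to a Lie algebra with basis $\{X_1,\dots,X_n\}$ belonging to one of the following two families (all constants lie in $\mathbb{K}$). First family: $$\left\{\begin{array}{l} [X_1,X_i]=X_{i+1},\quad i=2,3,4,\\ {[X_5,X_i]}=0\quad \text{for all } i,\\ {[X_2,X_3]}=aX_5,\\ {[X_2,X_k]}=a_kX_4+b_kX_5,\quad 6\le k\le n,\\ {[X_3,X_k]}=a_kX_5,\quad 6\le k\le n,\\ {[X_i,X_j]}=c_{i,j}X_5,\quad 6\le i<j\le n. \end{array}\right.$$ Second family: $$\left\{\begin{array}{l} [X_1,X_i]=X_{i+1},\quad i=2,3,4,\\ {[X_5,X_i]}=0\quad \text{for all } i,\\ {[X_2,X_3]}=aX_5+\sum_{k=6}^n d_kX_k,\\ {[X_2,X_k]}=b_kX_5,\quad 6\le k\le n,\\ {[X_i,X_j]}=c_{i,j}X_5,\quad 6\le i<j\le n, \end{array}\right.$$ with $$\sum_{i=6}^{j-1}c_{i,j}d_i-\sum_{i=j+1}^{n}c_{j,i}d_i=0\quad\text{for } 6\le j\le n.$$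
   Context: Breadth: $b(\mathfrak{g})=\max\{\operatorname{rank}(\operatorname{ad} X)\;:\; X\in\mathfrak{g}\}$. Characteristic sequence: let $\mathfrak{g}$ be a finite-dimensional nilpotent Lie algebra and $\mathcal{C}^1(\mathfrak{g})=[\mathfrak{g},\mathfrak{g}]$ its derived subalgebra. For $X\in\mathfrak{g}$ let $c(X)$ be the sequence, in decreasing order, of the dimensions of the Jordan blocks of the nilpotent operator $\operatorname{ad}X$. Then $c(\mathfrak{g})=\max\{c(X): X\in\mathfrak{g}\setminus\mathcal{C}^1(\mathfrak{g})\}$, the maximum being taken for the lexicographic order. Brackets of basis vectors that are not listed are zero or obtained by skew-symmetry. *)

theory Defs
  imports
    "HOL-Library.List_Lexorder"
    "Jordan_Normal_Form.Jordan_Normal_Form"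
begin

locale lie_algebra = vector_space scale
  for scale :: "'k::field \<Rightarrow> 'v::ab_group_add \<Rightarrow> 'v" +
  fixes bracket :: "'v \<Rightarrow> 'v \<Rightarrow> 'v"
  assumes linear_bracket_right: "Vector_Spaces.linear scale scale (\<lambda>y. bracket x y)"
    and linear_bracket_left: "Vector_Spaces.linear scale scale (\<lambda>x. bracket x y)"
    and bracket_self: "bracket x x = 0"
    and jacobi: "bracket x (bracket y z) + bracket y (bracket z x) + bracket z (bracket x y) = 0"

definition lie_isomorphic ::
  "('k::field \<Rightarrow> 'v::ab_group_add \<Rightarrow> 'v) \<Rightarrow> ('v \<Rightarrow> 'v \<Rightarrow> 'v) \<Rightarrow>
   ('k \<Rightarrow> 'w::ab_group_add \<Rightarrow> 'w) \<Rightarrow> ('w \<Rightarrow> 'w \<Rightarrow> 'w) \<Rightarrow> bool" where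
  "lie_isomorphic scale bracket scale' bracket' \<longleftrightarrow>
     (\<exists>\<phi>. Vector_Spaces.linear scale scale' \<phi> \<and> bij \<phi> \<and>
          (\<forall>x y. \<phi> (bracket x y) = bracket' (\<phi> x) (\<phi> y)))"

locale finite_dimensional_lie_algebra = lie_algebra +
  assumes finite_dimensional: "\<exists>B. finite B \<and> span B = UNIV"

context lie_algebra
begin

definition ordered_basis :: "'v list \<Rightarrow> bool" where
  "ordered_basis bs \<longleftrightarrow> distinct bs \<and> independent (set bs) \<and> span (set bs) = UNIV"

definition operator_matrix :: "'v list \<Rightarrow> ('v \<Rightarrow> 'v) \<Rightarrow> 'k mat" where
  "operator_matrix bs T =
     mat (length bs) (length bs) (\<lambda>(i, j). representation (set bs) (T (bs ! j)) (bs ! i))"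

text \<open>A relation rather than a function: it does not presuppose that a Jordan normal form
  exists. Where one exists, \<open>ms\<close> is determined by \<open>T\<close>.\<close>

definition jordan_block_dims :: "('v \<Rightarrow> 'v) \<Rightarrow> nat list \<Rightarrow> bool" where
  "jordan_block_dims T ms \<longleftrightarrow>
     (\<exists>bs n_as. ordered_basis bs \<and> jordan_nf (operator_matrix bs T) n_as \<and>
                ms = rev (sort (map fst n_as)))"

definition commutator_space :: "'v set \<Rightarrow> 'v set \<Rightarrow> 'v set" where
  "commutator_space A B = span {bracket x y | x y. x \<in> A \<and> y \<in> B}"

definition derived_subalgebra :: "'v set" where
  "derived_subalgebra = commutator_space UNIV UNIV"

primrec lower_central_series :: "nat \<Rightarrow> 'v set" where
  "lower_central_series 0 = UNIV"
| "lower_central_series (Suc i) = commutator_space UNIV (lower_central_series i)"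

definition nilpotent :: bool where
  "nilpotent \<longleftrightarrow> (\<exists>i. lower_central_series i = {0})"

text \<open>In finite dimension the ranks are bounded, so the maximum is attained.\<close>

definition breadth :: nat where
  "breadth = Max (range (\<lambda>x. dim (range (bracket x))))"

text \<open>Lists of naturals carry the lexicographic order of \<open>List_Lexorder\<close>. In a nonzero nilpotent
  Lie algebra of finite dimension \<open>n\<close> the set below is finite, because its members are
  partitions of \<open>n\<close>, and nonempty.\<close>

definition characteristic_sequence :: "nat list" where
  "characteristic_sequence =
     Max {ms. \<exists>x. x \<notin> derived_subalgebra \<and> jordan_block_dims (bracket x) ms}"

definition basis_family :: "nat \<Rightarrow> (nat \<Rightarrow> 'v) \<Rightarrow> bool" where
  "basis_family n X \<longleftrightarrow>
     inj_on X {1..n} \<and> independent (X ` {1..n}) \<and> span (X ` {1..n}) = UNIV"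

text \<open>The two predicates below list the complete multiplication table: the final \<open>else\<close> branches
  state that the remaining brackets vanish, and in particular that \<open>X 5\<close> is central. The
  brackets with \<open>i \<ge> j\<close> follow from skew-symmetry.\<close>

definition first_family :: "nat \<Rightarrow> (nat \<Rightarrow> 'v) \<Rightarrow> bool" where
  "first_family n X \<longleftrightarrow>
     (\<exists>(a :: 'k) (\<alpha> :: nat \<Rightarrow> 'k) (\<beta> :: nat \<Rightarrow> 'k) (c :: nat \<Rightarrow> nat \<Rightarrow> 'k).
        \<forall>i j. 1 \<le> i \<and> i < j \<and> j \<le> n \<longrightarrow>
          bracket (X i) (X j) =
            (if i = 1 \<and> j \<in> {2, 3, 4} then X (j + 1)
             else if i = 2 \<and> j = 3 then scale a (X 5)
             else if i = 2 \<and> 6 \<le> j then scale (\<alpha> j) (X 4) + scale (\<beta> j) (X 5)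
             else if i = 3 \<and> 6 \<le> j then scale (\<alpha> j) (X 5)
             else if 6 \<le> i then scale (c i j) (X 5)
             else 0))"

definition second_family :: "nat \<Rightarrow> (nat \<Rightarrow> 'v) \<Rightarrow> bool" where
  "second_family n X \<longleftrightarrow>
     (\<exists>(a :: 'k) (\<beta> :: nat \<Rightarrow> 'k) (d :: nat \<Rightarrow> 'k) (c :: nat \<Rightarrow> nat \<Rightarrow> 'k).
        (\<forall>i j. 1 \<le> i \<and> i < j \<and> j \<le> n \<longrightarrow>
          bracket (X i) (X j) =
            (if i = 1 \<and> j \<in> {2, 3, 4} then X (j + 1)
             else if i = 2 \<and> j = 3 then scale a (X 5) + (\<Sum>k = 6..n. scale (d k) (X k))
             else if i = 2 \<and> 6 \<le> j then scale (\<beta> j) (X 5)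
             else if 6 \<le> i then scale (c i j) (X 5)
             else 0)) \<and>
        (\<forall>j. 6 \<le> j \<and> j \<le> n \<longrightarrow>
          (\<Sum>i = 6..j - 1. c i j * d i) - (\<Sum>i = j + 1..n. c j i * d i) = 0))"

end

end

theory Submission
  imports Defs "Jordan_Normal_Form.Jordan_Normal_Form_Existence"
begin

text \<open>
  Choose \<open>x1\<close> outside the derived algebra whose adjoint operator \<open>T = ad x1\<close> has Jordan type
  \<open>(4,1,...,1)\<close>. Then \<open>T^3 \<noteq> 0\<close>, so some \<open>x2\<close> starts a chain \<open>x2\<close>, \<open>x3 = T x2\<close>, \<open>x4 = T x3\<close>,
  \<open>x5 = T x4 \<noteq> 0\<close>. Since the breadth is 3, the last three members span the image of \<open>T\<close>, and
  \<open>T x5 = 0\<close>.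

  The key point is that \<open>T\<close> has the largest rank among all operators \<open>ad x\<close>. In a pencil
  \<open>T + t B\<close> with \<open>B = ad z\<close> the rank therefore never exceeds that of \<open>T\<close>, and over an infinite
  field this forces two conditions (\<open>in_range_of_pencil\<close>). To first order, \<open>B\<close> maps the kernel of
  \<open>T\<close> into the image of \<open>T\<close>. To second order, if \<open>T y = 0\<close> and \<open>B y = T u\<close>, then \<open>B u\<close> lies in the
  image of \<open>T\<close> too.

  The first condition, the derivation property of \<open>T\<close> and nilpotency determine almost the whole
  multiplication table. Each kernel vector of \<open>T\<close> can be corrected by a multiple of \<open>x1\<close> so that
  its bracket with \<open>x2\<close> lies in the span of \<open>x4\<close> and \<open>x5\<close>; the corrected vectors form a space
  (\<open>tail_space\<close>) which, together with \<open>x1, ..., x4\<close>, spans the algebra and in which all brackets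
  are multiples of the central vector \<open>x5\<close>. Nilpotency shows that \<open>[x2,x3]\<close> is a multiple of \<open>x4\<close> plus a
  vector of this space (\<open>bracket_x2_x3\<close>), and replacing \<open>x2\<close> by \<open>x2 - r x1\<close> removes the
  multiple of \<open>x4\<close>.

  The second condition separates the two families. If \<open>[x2,y] = b x4 + c x5\<close> for some \<open>y\<close> in the
  space above, then \<open>u = b x3 + c x4\<close> is a preimage of this bracket under \<open>T\<close>, hence
  \<open>[x2,u] = b [x2,x3]\<close> lies in the image of \<open>T\<close>. So either \<open>[x2,x3]\<close> is a multiple of \<open>x5\<close>, which
  is the first family, or \<open>b = 0\<close> for all \<open>y\<close>, which is the second (\<open>dichotomy\<close>). The linear
  condition of the second family is the Jacobi identity for \<open>x2\<close>, \<open>x3\<close> and a vector of the space.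
\<close>

section \<open>Nilpotent operators and pencils of maximal rank\<close>

context vector_space
begin

lemma linear_funpow:
  assumes "Vector_Spaces.linear scale scale T"
  shows "Vector_Spaces.linear scale scale (T ^^ k)"
proof (induction k)
  case 0
  show ?case by (simp add: linear_ident)
next
  case (Suc k)
  show ?case
    using Vector_Spaces.linear_compose[OF Suc assms] by (simp add: comp_def)
qed

text \<open>The operator \<open>T ^^ k\<close> annihilates every member of the orbit after the first, hence their span,
  but not \<open>v\<close> itself.\<close>

lemma orbit_independent:
  assumes "Vector_Spaces.linear scale scale T"
    and "(T ^^ k) v \<noteq> 0" "(T ^^ Suc k) v = 0"
  shows "inj_on (\<lambda>i. (T ^^ i) v) {..k} \<and> independent ((\<lambda>i. (T ^^ i) v) ` {..k})"
  using assms(2,3)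
proof (induction k arbitrary: v)
  case 0
  then show ?case by simp
next
  case (Suc k)
  interpret P: Vector_Spaces.linear scale scale "T ^^ Suc k"
    by (rule linear_funpow[OF assms(1)])
  interpret T: Vector_Spaces.linear scale scale T by (rule assms(1))
  have T0: "(T ^^ j) 0 = 0" for j by (induction j) simp_all
  let ?tail = "(\<lambda>i. (T ^^ i) (T v)) ` {..k}"
  have IH: "inj_on (\<lambda>i. (T ^^ i) (T v)) {..k}" "independent ?tail"
    using Suc.IH[of "T v"] Suc.prems by (simp_all add: funpow_swap1)
  have dead: "(T ^^ Suc k) w = 0" if "w \<in> span ?tail" for w
  proof (rule P.eq_0_on_span[OF _ that])
    fix x assume "x \<in> ?tail"
    then obtain i where "x = (T ^^ i) (T v)" by blast
    then have "(T ^^ Suc k) x = (T ^^ (Suc k + i)) (T v)" by (simp add: funpow_add)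
    also have "\<dots> = (T ^^ (i + Suc k)) (T v)" by (simp only: add.commute)
    also have "\<dots> = (T ^^ i) ((T ^^ Suc (Suc k)) v)" by (simp add: funpow_add funpow_swap1)
    finally show "(T ^^ Suc k) x = 0" by (simp only: Suc.prems(2) T0)
  qed
  have v: "v \<notin> span ?tail" using dead Suc.prems(1) by blast
  have img: "(\<lambda>i. (T ^^ i) v) ` {..Suc k} = insert v ?tail"
    by (simp add: atMost_Suc_eq_insert_0 image_image funpow_swap1)
  have "inj_on (\<lambda>i. (T ^^ i) v) (Suc ` {..k})"
    using IH(1) by (simp add: inj_on_def funpow_swap1)
  moreover have "v \<notin> (\<lambda>i. (T ^^ i) v) ` (Suc ` {..k})"
    using v span_base[of v ?tail] by (auto simp: image_image funpow_swap1)
  ultimately have "inj_on (\<lambda>i. (T ^^ i) v) {..Suc k}"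
    by (auto simp: atMost_Suc_eq_insert_0 inj_on_insert)
  then show ?case
    using img independent_insertI[OF v IH(2)] by simp
qed

text \<open>On the quotient by \<open>W\<close> the vector \<open>v\<close> becomes an eigenvector of a nilpotent operator.\<close>

lemma nilpotent_eigenvalue_mod_subspace:
  assumes "Vector_Spaces.linear scale scale S" "subspace W" "\<And>w. w \<in> W \<Longrightarrow> S w \<in> W"
    and "(S ^^ m) v = 0" "S v - scale c v \<in> W" "v \<notin> W"
  shows "c = 0"
proof -
  interpret S: Vector_Spaces.linear scale scale S by (rule assms(1))
  have "(S ^^ k) v - scale (c ^ k) v \<in> W" for k
  proof (induction k)
    case 0
    show ?case using subspace_0[OF assms(2)] by simp
  next
    case (Suc k)
    have "(S ^^ Suc k) v - scale (c ^ Suc k) v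
        = S ((S ^^ k) v - scale (c ^ k) v) + scale (c ^ k) (S v - scale c v)"
      by (simp add: S.diff S.scale scale_right_diff_distrib mult.commute)
    then show ?case
      using subspace_add[OF assms(2) assms(3)[OF Suc] subspace_scale[OF assms(2,5)]] by metis
  qed
  from this[of m] have "scale (c ^ m) v \<in> W"
    using assms(2,4) subspace_neg by fastforce
  then have "scale (inverse (c ^ m)) (scale (c ^ m) v) \<in> W"
    by (rule subspace_scale[OF assms(2)])
  with assms(6) show "c = 0" by (cases "c = 0") auto
qed

end

context finite_dimensional_vector_space
begin

text \<open>Eigenvectors for distinct eigenvalues are independent, so there are at most as many eigenvalues
  as dimensions.\<close>

lemma finite_eigenvalues:
  assumes "Vector_Spaces.linear scale scale S"
  shows "finite {c. \<exists>w. w \<noteq> 0 \<and> S w = scale c w}" (is "finite ?E")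
proof (rule ccontr)
  assume inf: "infinite ?E"
  interpret S: Vector_Spaces.linear scale scale S by (rule assms)
  define w where "w c = (SOME w. w \<noteq> 0 \<and> S w = scale c w)" for c
  have w: "w c \<noteq> 0" "S (w c) = scale c (w c)" if "c \<in> ?E" for c
    using that someI_ex[of "\<lambda>w. w \<noteq> 0 \<and> S w = scale c w"] by (auto simp: w_def)
  have indep: "inj_on w \<Lambda> \<and> independent (w ` \<Lambda>)" if "finite \<Lambda>" "\<Lambda> \<subseteq> ?E" for \<Lambda>
    using that
  proof (induction \<Lambda>)
    case empty
    show ?case by (simp add: independent_empty)
  next
    case (insert c \<Lambda>)
    have inj: "inj_on w \<Lambda>" and ind: "independent (w ` \<Lambda>)" using insert by auto
    have "w c \<notin> span (w ` \<Lambda>)"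
    proof
      assume "w c \<in> span (w ` \<Lambda>)"
      then obtain u where u: "w c = (\<Sum>v\<in>w ` \<Lambda>. scale (u v) v)"
        using span_finite[of "w ` \<Lambda>"] insert.hyps(1) by auto
      define a where "a l = u (w l)" for l
      have wc: "w c = (\<Sum>l\<in>\<Lambda>. scale (a l) (w l))"
        unfolding u a_def by (simp add: sum.reindex[OF inj])
      have "scale c (w c) = S (w c)" using w(2) insert.prems by simp
      also have "\<dots> = (\<Sum>l\<in>\<Lambda>. scale (a l * l) (w l))"
        unfolding wc S.sum using insert.prems w(2)
        by (intro sum.cong refl) (simp add: S.scale subset_iff)
      finally have "(\<Sum>l\<in>\<Lambda>. scale (a l * (l - c)) (w l)) = 0"
        unfolding wc
        by (simp add: scale_sum_right right_diff_distrib scale_left_diff_distrib sum_subtractf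
            mult.commute)
      then have "(\<Sum>v\<in>w ` \<Lambda>. scale (u v * (inv_into \<Lambda> w v - c)) v) = 0"
        unfolding a_def by (simp add: sum.reindex[OF inj] inv_into_f_f[OF inj])
      from independentD[OF ind finite_imageI[OF insert.hyps(1)] order_refl this]
      have "a l * (l - c) = 0" if "l \<in> \<Lambda>" for l
        unfolding a_def using that by (force simp: inv_into_f_f[OF inj])
      then have "a l = 0" if "l \<in> \<Lambda>" for l using that insert.hyps(2) by auto
      then have "w c = 0" unfolding wc by simp
      then show False using w(1) insert.prems by blast
    qed
    then show ?case
      using inj independent_insertI[OF _ ind] span_base[of "w c" "w ` \<Lambda>"]
        by (auto simp: inj_on_insert)
  qed
  obtain \<Lambda> where L: "finite \<Lambda>" "card \<Lambda> = Suc dimension" "\<Lambda> \<subseteq> ?E"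
    using infinite_arbitrarily_large[OF inf] by blast
  have "card (w ` \<Lambda>) = Suc dimension"
    using indep[OF L(1,3)] L(2) by (simp add: card_image)
  moreover have "card (w ` \<Lambda>) \<le> dim UNIV"
    using indep[OF L(1,3)] by (intro independent_card_le_dim) auto
  ultimately show False by (simp add: dimension_def)
qed

text \<open>Extend \<open>f\<close> to a linear map \<open>S\<close>. The map \<open>1 + t S\<close> fails to be injective only if \<open>-1/t\<close> is an
  eigenvalue of \<open>S\<close>, which excludes finitely many \<open>t\<close>.\<close>

lemma independent_perturbation:
  fixes f :: "'b \<Rightarrow> 'b"
  assumes "infinite (UNIV :: 'a set)" "independent U"
  obtains t where "t \<noteq> 0" "inj_on (\<lambda>u. u + scale t (f u)) U"
    "independent ((\<lambda>u. u + scale t (f u)) ` U)"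
proof -
  interpret pair: vector_space_pair scale scale ..
  obtain S where S: "Vector_Spaces.linear scale scale S" "\<And>u. u \<in> U \<Longrightarrow> S u = f u"
    using pair.linear_independent_extend[OF assms(2), of f] by blast
  let ?E = "{c. \<exists>w. w \<noteq> 0 \<and> S w = scale c w}"
  have "finite (insert 0 ((\<lambda>c. - inverse c) ` ?E))"
    using finite_eigenvalues[OF S(1)] by simp
  from ex_new_if_finite[OF assms(1) this]
  obtain t where t: "t \<noteq> 0" "t \<notin> (\<lambda>c. - inverse c) ` ?E" by auto
  interpret S: Vector_Spaces.linear scale scale S by (rule S(1))
  let ?G = "\<lambda>x. x + scale t (S x)"
  interpret G: Vector_Spaces.linear scale scale ?G
    by unfold_locales (simp_all add: S.add S.scale scale_right_distrib scale_left_commute)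
  have "x = 0" if "?G x = 0" for x
  proof (rule ccontr)
    assume "x \<noteq> 0"
    have "scale (- inverse t) (- scale t (S x)) = S x" using t(1) by simp
    moreover have "- scale t (S x) = x" using that by (simp add: neg_eq_iff_add_eq_0 add.commute)
    ultimately have "- inverse t \<in> ?E" using \<open>x \<noteq> 0\<close> by (auto intro!: exI[of _ x])
    then have "- inverse (- inverse t) \<in> (\<lambda>c. - inverse c) ` ?E" by blast
    with t show False by simp
  qed
  then have inj: "inj ?G" unfolding G.inj_iff_eq_0 by blast
  have "independent (?G ` U)"
    using G.independent_injective_image[OF assms(2)] inj inj_on_subset by blast
  moreover have "inj_on ?G U" using inj inj_on_subset by blast
  moreover have "?G ` U = (\<lambda>u. u + scale t (f u)) ` U" using S(2) by (simp cong: image_cong)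
  moreover have "inj_on ?G U = inj_on (\<lambda>u. u + scale t (f u)) U"
    using S(2) by (simp cong: inj_on_cong)
  ultimately show thesis using t(1) that by metis
qed

text \<open>If \<open>w\<close> were outside the range of \<open>T\<close>, it would enlarge a basis of that range. Perturb the basis
  vectors \<open>T x\<close> to \<open>T x + t B x\<close> and keep \<open>w\<close> fixed: for a suitable \<open>t\<close> the vectors stay
  independent, and they all lie in the range of \<open>T + t B\<close>, whose rank would then exceed that of \<open>T\<close>.\<close>

lemma in_range_of_maximal_rank:
  assumes "infinite (UNIV :: 'a set)" "Vector_Spaces.linear scale scale T"
    and "\<And>t. dim (range (\<lambda>x. T x + scale t (B x))) \<le> dim (range T)"
    and "\<And>t. t \<noteq> 0 \<Longrightarrow> w \<in> range (\<lambda>x. T x + scale t (B x))"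
  shows "w \<in> range T"
proof (rule ccontr)
  assume w: "w \<notin> range T"
  interpret T: Vector_Spaces.linear scale scale T by (rule assms(2))
  have sub: "subspace (range T)" by (rule T.subspace_image) simp
  obtain U where finU: "finite U" and U: "U \<subseteq> range T" "independent U" "span U = range T"
    "card U = dim (range T)"
    by (rule basis_subspace_exists[OF sub])
  have "w \<notin> U" using U(1) w by blast
  have ind: "independent (insert w U)"
    using independent_insertI[OF _ U(2)] w U(3) by blast
  define f where "f u = (if u = w then 0 else B (inv_into UNIV T u))" for u
  obtain t where t: "t \<noteq> 0" "inj_on (\<lambda>u. u + scale t (f u)) (insert w U)"
    "independent ((\<lambda>u. u + scale t (f u)) ` insert w U)" (is "independent ?I")
    using independent_perturbation[OF assms(1) ind, of f] by blast
  have "?I \<subseteq> range (\<lambda>x. T x + scale t (B x))"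
  proof
    fix y assume "y \<in> ?I"
    then obtain u where u: "u \<in> insert w U" "y = u + scale t (f u)" by blast
    show "y \<in> range (\<lambda>x. T x + scale t (B x))"
    proof (cases "u = w")
      case True
      then show ?thesis using assms(4)[OF t(1)] u(2) by (simp add: f_def)
    next
      case False
      then have "y = T (inv_into UNIV T u) + scale t (B (inv_into UNIV T u))"
        using U(1) u by (simp add: f_def f_inv_into_f subsetD)
      then show ?thesis by blast
    qed
  qed
  then have "card ?I \<le> dim (range (\<lambda>x. T x + scale t (B x)))"
    using t(3) by (rule independent_card_le_dim)
  also have "\<dots> \<le> card U" using assms(3) U(4) by simp
  finally show False
    using card_image[OF t(2)] finU \<open>w \<notin> U\<close> by simp
qed

text \<open>A triangular independent list of maximal length must span: for \<open>v\<close> outside its span, the last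
  iterate \<open>(T ^^ l) v\<close> outside the span could be appended.\<close>

lemma nilpotent_triangular_basis:
  assumes "Vector_Spaces.linear scale scale T" "\<And>y. (T ^^ m) y = 0"
  obtains bs where "distinct bs" "independent (set bs)" "span (set bs) = UNIV"
    "\<And>j. j < length bs \<Longrightarrow> T (bs ! j) \<in> span (set (take j bs))"
proof -
  let ?P = "\<lambda>bs. distinct bs \<and> independent (set bs) \<and>
    (\<forall>j < length bs. T (bs ! j) \<in> span (set (take j bs)))"
  have bound: "length bs \<le> dimension" if "?P bs" for bs
    using that independent_card_le_dim[of "set bs" UNIV]
    by (simp add: distinct_card[symmetric] dimension_def)
  have "?P []" by (simp add: independent_empty)
  from ex_has_greatest_nat[of ?P, OF this, of length "Suc dimension"] bound
  obtain bs where bs: "?P bs" and max: "\<And>cs. ?P cs \<Longrightarrow> length cs \<le> length bs"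
    by (metis (no_types, lifting) less_Suc_eq_le)
  have "span (set bs) = UNIV"
  proof (rule ccontr)
    assume "span (set bs) \<noteq> UNIV"
    then obtain v where v: "v \<notin> span (set bs)" by blast
    have "\<exists>k. (T ^^ k) v \<in> span (set bs)" using assms(2) span_zero by metis
    then obtain k where k: "(T ^^ k) v \<in> span (set bs)" "\<And>l. l < k \<Longrightarrow> (T ^^ l) v \<notin> span (set bs)"
      using exists_least_iff[of "\<lambda>k. (T ^^ k) v \<in> span (set bs)"] by blast
    then obtain l where "k = Suc l" using v by (cases k) auto
    then obtain w where w: "w \<notin> span (set bs)" "T w \<in> span (set bs)" using k by force
    have "?P (bs @ [w])"
      using bs w span_base[of w "set bs"] independent_insertI[OF w(1)]
      by (auto simp: nth_append less_Suc_eq)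
    from max[OF this] show False by simp
  qed
  with bs that show thesis by blast
qed

end

section \<open>Jordan types and the characteristic sequence\<close>

lemma diag_block_mat_0D:
  assumes "diag_block_mat As = 0\<^sub>m m n" "A \<in> set As"
  shows "A = 0\<^sub>m (dim_row A) (dim_col A)"
  using assms
proof (induction As arbitrary: m n)
  case Nil
  then show ?case by simp
next
  case (Cons C As)
  let ?D = "diag_block_mat As"
  let ?F = "four_block_mat C (0\<^sub>m (dim_row C) (dim_col ?D)) (0\<^sub>m (dim_row ?D) (dim_col C)) ?D"
  have F: "?F = 0\<^sub>m m n" using Cons.prems(1) by (simp add: Let_def)
  have dims: "m = dim_row C + dim_row ?D" "n = dim_col C + dim_col ?D"
    using arg_cong[OF F, of dim_row] arg_cong[OF F, of dim_col] by simp_all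
  have entry: "?F $$ (i, j) = 0" if "i < m" "j < n" for i j
    using that by (simp only: F index_zero_mat)
  show ?case
  proof (cases "A = C")
    case True
    have "C $$ (i, j) = 0" if "i < dim_row C" "j < dim_col C" for i j
      using entry[of i j] that dims by simp
    then show ?thesis using True by (auto intro: eq_matI)
  next
    case False
    have "?D $$ (i, j) = 0" if "i < dim_row ?D" "j < dim_col ?D" for i j
      using entry[of "i + dim_row C" "j + dim_col C"] that dims by simp
    then have "?D = 0\<^sub>m (dim_row ?D) (dim_col ?D)" by (auto intro: eq_matI)
    from Cons.IH[OF this] show ?thesis using Cons.prems(2) False by simp
  qed
qed

text \<open>The entry in row \<open>0\<close> and column \<open>r\<close> of the \<open>r\<close>-th power of a Jordan block of size greater than
  \<open>r\<close> is \<open>1\<close>, for every eigenvalue.\<close>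

lemma jordan_nf_block_le_nilpotency_index:
  fixes M :: "'a::field mat"
  assumes M: "M \<in> carrier_mat n n" "M ^\<^sub>m r = 0\<^sub>m n n"
    and nf: "jordan_nf M n_as" "(k, a) \<in> set n_as"
  shows "k \<le> r"
proof (rule ccontr)
  assume "\<not> k \<le> r"
  let ?J = "jordan_matrix n_as"
  obtain P Q where wit: "similar_mat_wit ?J M P Q"
    using nf(1) similar_mat_sym unfolding jordan_nf_def similar_mat_def by blast
  note PQM = similar_mat_witD(5-7)[OF refl wit]
  then have "n = dim_row ?J" using M(1) by (metis carrier_matD(1))
  then have "?J ^\<^sub>m r = 0\<^sub>m n n"
    using similar_mat_wit_pow_id[OF wit, of r] M(2) PQM by simp
  then have "diag_block_mat (map (\<lambda>(n, a). jordan_block n a ^\<^sub>m r) n_as) = 0\<^sub>m n n"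
    by (simp add: jordan_matrix_pow)
  from diag_block_mat_0D[OF this, of "jordan_block k a ^\<^sub>m r"] nf(2)
  have "jordan_block k a ^\<^sub>m r = 0\<^sub>m k k" by force
  then have "(jordan_block k a ^\<^sub>m r) $$ (0, r) = 0" using \<open>\<not> k \<le> r\<close> by simp
  then show False using \<open>\<not> k \<le> r\<close> by (simp add: jordan_block_pow)
qed

context lie_algebra
begin

lemma operator_matrix_carrier: "operator_matrix bs T \<in> carrier_mat (length bs) (length bs)"
  by (simp add: operator_matrix_def)

lemma operator_matrix_comp:
  assumes bs: "ordered_basis bs" and f: "Vector_Spaces.linear scale scale f"
  shows "operator_matrix bs (f \<circ> g) = operator_matrix bs f * operator_matrix bs g"
proof (rule eq_matI)
  interpret f: Vector_Spaces.linear scale scale f by (rule f)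
  have ind: "independent (set bs)" and sp: "span (set bs) = UNIV" and dist: "distinct bs"
    using bs by (auto simp: ordered_basis_def)
  let ?rep = "representation (set bs)"
  fix i j
  assume "i < dim_row (operator_matrix bs f * operator_matrix bs g)"
    "j < dim_col (operator_matrix bs f * operator_matrix bs g)"
  then have ij: "i < length bs" "j < length bs" by (simp_all add: operator_matrix_def)
  have "g (bs ! j) = (\<Sum>b\<in>set bs. scale (?rep (g (bs ! j)) b) b)"
    using sum_representation_eq[OF ind, of "g (bs ! j)" "set bs"] sp by simp
  then have "f (g (bs ! j)) = (\<Sum>b\<in>set bs. scale (?rep (g (bs ! j)) b) (f b))"
    by (metis (no_types, lifting) f.scale f.sum sum.cong)
  then have "?rep (f (g (bs ! j))) (bs ! i)
      = (\<Sum>b\<in>set bs. ?rep (g (bs ! j)) b * ?rep (f b) (bs ! i))"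
    using sp by (simp add: representation_sum[OF ind] representation_scale[OF ind])
  also have "\<dots> = (\<Sum>k = 0..<length bs. ?rep (g (bs ! j)) (bs ! k) * ?rep (f (bs ! k)) (bs ! i))"
    by (rule sum.reindex_bij_betw[symmetric])
      (rule bij_betw_nth[OF dist], simp_all add: atLeast0LessThan)
  also have "\<dots> = (operator_matrix bs f * operator_matrix bs g) $$ (i, j)"
    using ij by (simp add: operator_matrix_def times_mat_def scalar_prod_def mult.commute)
  finally show "operator_matrix bs (f \<circ> g) $$ (i, j)
      = (operator_matrix bs f * operator_matrix bs g) $$ (i, j)"
    using ij by (simp add: operator_matrix_def)
qed (simp_all add: operator_matrix_def)

lemma operator_matrix_funpow:
  assumes bs: "ordered_basis bs" and T: "Vector_Spaces.linear scale scale T"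
  shows "operator_matrix bs (T ^^ r) = operator_matrix bs T ^\<^sub>m r"
proof (induction r)
  case 0
  have "independent (set bs)" "distinct bs" using bs by (auto simp: ordered_basis_def)
  then show ?case
    by (auto simp: operator_matrix_def representation_basis nth_eq_iff_index_eq)
next
  case (Suc r)
  have "T ^^ Suc r = (T ^^ r) \<circ> T" by (rule funpow_Suc_right)
  then show ?case
    using operator_matrix_comp[OF bs linear_funpow[OF T], of r T] Suc
    by (simp only: pow_mat.simps)
qed

lemma jordan_block_dims_le_nilpotency_index:
  assumes T: "Vector_Spaces.linear scale scale T" "\<And>y. (T ^^ r) y = 0"
    and "jordan_block_dims T ms" "k \<in> set ms"
  shows "k \<le> r"
proof -
  obtain bs n_as where bs: "ordered_basis bs" and nf: "jordan_nf (operator_matrix bs T) n_as"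
    and ms: "ms = rev (sort (map fst n_as))"
    using assms(3) unfolding jordan_block_dims_def by blast
  have "independent (set bs)" using bs by (simp add: ordered_basis_def)
  then have "operator_matrix bs T ^\<^sub>m r = 0\<^sub>m (length bs) (length bs)"
    unfolding operator_matrix_funpow[OF bs T(1), symmetric]
    by (auto simp: operator_matrix_def T(2) representation_zero)
  moreover obtain a where "(k, a) \<in> set n_as" using assms(4) ms by auto
  ultimately show ?thesis
    using jordan_nf_block_le_nilpotency_index[OF operator_matrix_carrier _ nf] by blast
qed

text \<open>The Jordan types are partitions of the dimension; this bound makes the set of Jordan types finite,
  so that the maximum in the definition of the characteristic sequence is attained.\<close>

lemma jordan_block_dims_bounded:
  assumes "jordan_block_dims T ms"
  shows "set ms \<subseteq> {..dim (UNIV :: 'v set)} \<and> length ms \<le> dim (UNIV :: 'v set)"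
proof -
  obtain bs n_as where bs: "ordered_basis bs" and nf: "jordan_nf (operator_matrix bs T) n_as"
    and ms: "ms = rev (sort (map fst n_as))"
    using assms unfolding jordan_block_dims_def by blast
  have "similar_mat (operator_matrix bs T) (jordan_matrix n_as)" and pos: "0 \<notin> fst ` set n_as"
    using nf by (simp_all add: jordan_nf_def)
  then obtain P Q where "similar_mat_wit (operator_matrix bs T) (jordan_matrix n_as) P Q"
    unfolding similar_mat_def by blast
  from carrier_matD(1)[OF similar_mat_witD(5)[OF refl this]]
  have "dim_row (jordan_matrix n_as) = dim_row (operator_matrix bs T)" .
  moreover have "length bs = dim (UNIV :: 'v set)"
    using bs by (metis ordered_basis_def distinct_card dim_eq_card_independent dim_span)
  ultimately have sum: "sum_list (map fst n_as) = dim (UNIV :: 'v set)"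
    by (simp add: operator_matrix_def)
  have "set ms \<subseteq> {..dim (UNIV :: 'v set)}"
    using member_le_sum_list[of _ "map fst n_as"] sum ms by auto
  moreover have "length n_as \<le> sum_list (map fst n_as)"
    using pos by (induction n_as) fastforce+
  ultimately show ?thesis using sum ms by simp
qed

lemma ad_nilpotent:
  assumes nilpotent
  obtains m where "\<And>x y. (bracket x ^^ m) y = 0"
proof -
  obtain m where m: "lower_central_series m = {0}" using assms by (auto simp: nilpotent_def)
  have "(bracket x ^^ i) y \<in> lower_central_series i" for x y i
  proof (induction i)
    case (Suc i)
    then show ?case by (auto simp: commutator_space_def intro!: span_base)
  qed simp
  from this[of m] m that show thesis by auto
qed

lemma derived_subalgebra_proper:
  assumes nilpotent "(UNIV :: 'v set) \<noteq> {0}"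
  shows "derived_subalgebra \<noteq> UNIV"
proof
  assume "derived_subalgebra = UNIV"
  then have "lower_central_series i = UNIV" for i
    by (induction i) (simp_all add: derived_subalgebra_def)
  then show False using assms by (auto simp: nilpotent_def)
qed

end

context finite_dimensional_lie_algebra
begin

lemma finite_basis:
  obtains Basis where "finite_dimensional_vector_space scale Basis"
proof -
  obtain G where G: "finite G" "span G = UNIV" using finite_dimensional by blast
  obtain Basis where "independent Basis" "UNIV \<subseteq> span Basis" by (rule basis_exists[of UNIV])
  moreover from this have "finite Basis" using independent_span_bound[OF G(1)] G(2) by simp
  ultimately have "finite_dimensional_vector_space scale Basis"
    by unfold_locales auto
  then show thesis by (rule that)
qed

text \<open>Over an arbitrary field a nilpotent operator has a Jordan normal form, because its matrix in a
  triangular basis is upper triangular.\<close>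

lemma nilpotent_jordan_block_dims_exist:
  assumes T: "Vector_Spaces.linear scale scale T" "\<And>y. (T ^^ m) y = 0"
  shows "\<exists>ms. jordan_block_dims T ms"
proof -
  obtain Basis where "finite_dimensional_vector_space scale Basis" by (rule finite_basis)
  then interpret finite_dimensional_vector_space scale Basis .
  obtain bs where bs: "distinct bs" "independent (set bs)" "span (set bs) = UNIV"
    and tri: "\<And>j. j < length bs \<Longrightarrow> T (bs ! j) \<in> span (set (take j bs))"
    using nilpotent_triangular_basis[OF T] by blast
  have "operator_matrix bs T $$ (i, j) = 0" if "j < i" "i < length bs" for i j
  proof -
    have "representation (set bs) (T (bs ! j)) = representation (set (take j bs)) (T (bs ! j))"
      using that by (intro representation_extend[OF bs(2)] tri set_take_subset) simp
    moreover have "bs ! i \<notin> set (take j bs)"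
      using that bs(1) by (auto simp: in_set_conv_nth nth_eq_iff_index_eq)
    ultimately show ?thesis
      using that representation_ne_zero by (fastforce simp: operator_matrix_def)
  qed
  then have "upper_triangular (operator_matrix bs T)"
    by (auto simp: operator_matrix_def)
  then have "\<exists>n_as. jordan_nf (operator_matrix bs T) n_as"
    using triangular_to_jnf_vector[OF operator_matrix_carrier] by blast
  then show ?thesis using bs unfolding jordan_block_dims_def ordered_basis_def by blast
qed

lemma characteristic_sequence_attained:
  assumes nilpotent "(UNIV :: 'b set) \<noteq> {0}"
  shows "\<exists>x. x \<notin> derived_subalgebra \<and> jordan_block_dims (bracket x) characteristic_sequence"
proof -
  let ?S = "{ms. \<exists>x. x \<notin> derived_subalgebra \<and> jordan_block_dims (bracket x) ms}"
  let ?n = "dim (UNIV :: 'b set)"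
  have "?S \<subseteq> {ms. set ms \<subseteq> {..?n} \<and> length ms \<le> ?n}"
    using jordan_block_dims_bounded by blast
  then have "finite ?S" using finite_lists_length_le[of "{..?n}" ?n] finite_subset by blast
  moreover obtain x where "x \<notin> derived_subalgebra" using derived_subalgebra_proper[OF assms] by blast
  moreover obtain m where m: "\<And>x y. (bracket x ^^ m) y = 0"
    by (rule ad_nilpotent[OF assms(1)]) blast
  have "\<exists>ms. jordan_block_dims (bracket x) ms" for x
    by (rule nilpotent_jordan_block_dims_exist[OF linear_bracket_right m])
  with \<open>x \<notin> derived_subalgebra\<close> have "?S \<noteq> {}" by blast
  ultimately have "characteristic_sequence \<in> ?S"
    unfolding characteristic_sequence_def by (intro Max_in) auto
  then show ?thesis by simp
qed

lemma rank_le_breadth: "dim (range (bracket x)) \<le> breadth"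
proof -
  obtain Basis where "finite_dimensional_vector_space scale Basis" by (rule finite_basis)
  then interpret finite_dimensional_vector_space scale Basis .
  have "range (\<lambda>x. dim (range (bracket x))) \<subseteq> {..dimension}"
    using dim_subset_UNIV by auto
  then have "finite (range (\<lambda>x. dim (range (bracket x))))" using finite_subset by blast
  then show ?thesis unfolding breadth_def by (intro Max_ge) auto
qed

end

section \<open>Lie algebras of breadth three with a long orbit\<close>

context lie_algebra
begin

lemma bracket_add_right: "bracket x (y + z) = bracket x y + bracket x z"
  and bracket_scale_right: "bracket x (scale c y) = scale c (bracket x y)"
  using linear_bracket_right[of x] by (simp_all add: Vector_Spaces.linear_iff)

lemma bracket_add_left: "bracket (x + y) z = bracket x z + bracket y z"
  and bracket_scale_left: "bracket (scale c x) z = scale c (bracket x z)"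
  using linear_bracket_left[of z] by (simp_all add: Vector_Spaces.linear_iff)

lemma bracket_zero: "bracket x 0 = 0" "bracket 0 x = 0"
  using bracket_scale_right[of x 0 0] bracket_scale_left[of 0 0 x] by simp_all

lemma bracket_minus: "bracket x (- y) = - bracket x y" "bracket (- x) y = - bracket x y"
  using bracket_scale_right[of x "-1" y] bracket_scale_left[of "-1" x y] by simp_all

lemma bracket_diff:
  "bracket x (y - z) = bracket x y - bracket x z" "bracket (x - y) z = bracket x z - bracket y z"
  using bracket_add_right[of x y "- z"] bracket_add_left[of x "- y" z]
  by (simp_all add: bracket_minus)

lemmas bracket_bilinear = bracket_add_right bracket_add_left bracket_scale_right
  bracket_scale_left bracket_zero bracket_minus bracket_diff

lemma bracket_sum_left: "bracket (\<Sum>i\<in>I. f i) y = (\<Sum>i\<in>I. bracket (f i) y)"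
  by (induction I rule: infinite_finite_induct) (simp_all add: bracket_zero bracket_add_left)

lemma bracket_antisym: "bracket y x = - bracket x y"
proof -
  have "bracket (x + y) (x + y) = bracket y x + bracket x y"
    by (simp add: bracket_add_right bracket_add_left bracket_self[of x] bracket_self[of y])
  then show ?thesis by (simp add: bracket_self eq_neg_iff_add_eq_0)
qed

lemma bracket_derivation:
  "bracket x (bracket y z) = bracket (bracket x y) z + bracket y (bracket x z)"
proof -
  have "bracket x (bracket y z) = - bracket y (bracket z x) - bracket z (bracket x y)"
    using jacobi[of x y z] by (simp add: algebra_simps eq_neg_iff_add_eq_0)
  then show ?thesis
    using bracket_antisym[of z "bracket x y"] bracket_antisym[of z x]
    by (simp add: bracket_minus)
qed

end

text \<open>The situation produced by the hypotheses on breadth and characteristic sequence, freed from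
  Jordan forms: all adjoint operators are nilpotent of rank at most 3, and \<open>x2\<close> survives three
  applications of \<open>ad x1\<close>.\<close>

locale breadth_3_pair = finite_dimensional_lie_algebra scale bracket
  for scale :: "'k::field \<Rightarrow> 'v::ab_group_add \<Rightarrow> 'v" and bracket +
  fixes x1 x2 :: 'v
  assumes infinite_field: "infinite (UNIV :: 'k set)"
    and ad_nil: "\<exists>m. \<forall>x y. (bracket x ^^ m) y = 0"
    and rank_le: "dim (range (bracket x)) \<le> 3"
    and long_orbit: "bracket x1 (bracket x1 (bracket x1 x2)) \<noteq> 0"
begin

definition "x3 = bracket x1 x2"
definition "x4 = bracket x1 x3"
definition "x5 = bracket x1 x4"

lemma x5_nonzero: "x5 \<noteq> 0"
  using long_orbit by (simp add: x3_def x4_def x5_def)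

lemma orbit_simps: "bracket x1 x2 = x3" "bracket x1 x3 = x4" "bracket x1 x4 = x5"
  by (simp_all add: x3_def x4_def x5_def)

text \<open>Otherwise the orbit of \<open>x2\<close> would contain four independent vectors in the range of \<open>ad x1\<close>, namely
  its last four nonzero members.\<close>

lemma bracket_x1_x5: "bracket x1 x5 = 0"
proof (rule ccontr)
  assume ne: "bracket x1 x5 \<noteq> 0"
  let ?T = "bracket x1"
  obtain Basis where "finite_dimensional_vector_space scale Basis" by (rule finite_basis)
  then interpret finite_dimensional_vector_space scale Basis .
  obtain N where N: "(?T ^^ N) x5 = 0" "\<And>l. l < N \<Longrightarrow> (?T ^^ l) x5 \<noteq> 0"
    using ad_nil exists_least_iff[of "\<lambda>N. (?T ^^ N) x5 = 0"] by blast
  obtain M where M: "N = Suc (Suc M)"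
    using N(1) ne x5_nonzero by (cases N rule: nat.exhaust; cases "N - 1") auto
  let ?v = "(?T ^^ M) x3"
  have v: "(?T ^^ 3) ?v = (?T ^^ Suc M) x5" "(?T ^^ Suc 3) ?v = (?T ^^ N) x5"
    by (simp_all add: M numeral_3_eq_3 funpow_swap1 orbit_simps)
  have "(?T ^^ 3) ?v \<noteq> 0" "(?T ^^ Suc 3) ?v = 0"
    unfolding v using N(1) N(2)[of "Suc M"] by (simp_all only: M lessI not_False_eq_True)
  then have "inj_on (\<lambda>i. (?T ^^ i) ?v) {..3} \<and> independent ((\<lambda>i. (?T ^^ i) ?v) ` {..3})"
    by (intro orbit_independent linear_bracket_right)
  moreover have "(\<lambda>i. (?T ^^ i) ?v) ` {..3} \<subseteq> range ?T"
    by (auto simp: funpow_swap1 x3_def simp flip: funpow_swap1)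
  ultimately have "4 \<le> dim (range ?T)"
    using independent_card_le_dim[of "(\<lambda>i. (?T ^^ i) ?v) ` {..3}" "range ?T"]
    by (simp add: card_image)
  with rank_le[of x1] show False by simp
qed

lemma range_ad_x1: "range (bracket x1) = span {x3, x4, x5}" "dim (range (bracket x1)) = 3"
proof -
  let ?T = "bracket x1"
  obtain Basis where "finite_dimensional_vector_space scale Basis" by (rule finite_basis)
  then interpret finite_dimensional_vector_space scale Basis .
  interpret T: Vector_Spaces.linear scale scale ?T by (rule linear_bracket_right)
  have orbit: "(?T ^^ 0) x3 = x3" "(?T ^^ 1) x3 = x4" "(?T ^^ 2) x3 = x5" "(?T ^^ Suc 2) x3 = 0"
    using orbit_simps bracket_x1_x5 by (simp_all add: numeral_2_eq_2)
  have "inj_on (\<lambda>i. (?T ^^ i) x3) {..2} \<and> independent ((\<lambda>i. (?T ^^ i) x3) ` {..2})"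
    using orbit x5_nonzero by (intro orbit_independent linear_bracket_right) auto
  then have inj: "inj_on (\<lambda>i. (?T ^^ i) x3) {..2}" and ind: "independent ((\<lambda>i. (?T ^^ i) x3) ` {..2})"
    by blast+
  have "{..2::nat} = {0, 1, 2}" by auto
  then have im: "(\<lambda>i. (?T ^^ i) x3) ` {..2} = {x3, x4, x5}"
    using orbit by (simp only: image_insert image_empty)
  have card: "card {x3, x4, x5} = 3"
    using card_image[OF inj] unfolding im by simp
  note ind = ind[unfolded im]
  have sub: "{x3, x4, x5} \<subseteq> range ?T" by (simp flip: orbit_simps)
  show "dim (range ?T) = 3"
    using independent_card_le_dim[OF sub ind] card rank_le[of x1] by simp
  have "range ?T \<subseteq> span {x3, x4, x5}"
    using card_ge_dim_independent[OF sub ind] card rank_le[of x1] by simp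
  moreover have "span {x3, x4, x5} \<subseteq> range ?T"
    by (rule span_minimal[OF sub]) (rule T.subspace_image, simp)
  ultimately show "range ?T = span {x3, x4, x5}" by blast
qed

lemma in_range_ad_x1: "v \<in> range (bracket x1) \<longleftrightarrow>
    (\<exists>a b c. v = scale a x3 + scale b x4 + scale c x5)"
  by (simp only: range_ad_x1(1) span_breakdown_eq span_empty singleton_iff diff_diff_eq right_minus_eq)

lemma in_span_x5: "v \<in> span {x5} \<longleftrightarrow> (\<exists>c. v = scale c x5)"
  by (auto simp: span_singleton)

lemma in_span_x4_x5: "v \<in> span {x4, x5} \<longleftrightarrow> (\<exists>b c. v = scale b x4 + scale c x5)"
  by (simp only: span_breakdown_eq span_empty singleton_iff diff_diff_eq right_minus_eq)

lemma x4_notin: "x4 \<notin> span {x5}" and x3_notin: "x3 \<notin> span {x4, x5}"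
proof -
  show "x4 \<notin> span {x5}"
    using orbit_simps(3) x5_nonzero by (auto simp: in_span_x5 bracket_bilinear bracket_x1_x5)
  show "x3 \<notin> span {x4, x5}"
  proof
    assume "x3 \<in> span {x4, x5}"
    then obtain b c where "x3 = scale b x4 + scale c x5" by (auto simp: in_span_x4_x5)
    from arg_cong[OF this, of "\<lambda>v. bracket x1 (bracket x1 v)"] show False
      using x5_nonzero by (simp add: bracket_bilinear orbit_simps bracket_x1_x5)
  qed
qed

text \<open>By \<open>range_ad_x1\<close> the rank of \<open>ad x1\<close> is the largest possible one, so \<open>ad x1\<close> has maximal rank in
  every pencil \<open>ad (x1 + t z)\<close>.\<close>

lemma in_range_of_pencil:
  assumes "\<And>t. t \<noteq> 0 \<Longrightarrow> \<exists>y. bracket x1 y + scale t (bracket z y) = w"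
  shows "w \<in> range (bracket x1)"
proof -
  obtain Basis where "finite_dimensional_vector_space scale Basis" by (rule finite_basis)
  then interpret finite_dimensional_vector_space scale Basis .
  show ?thesis
  proof (rule in_range_of_maximal_rank[OF infinite_field linear_bracket_right, where B = "bracket z"])
    fix t
    have "bracket (x1 + scale t z) = (\<lambda>y. bracket x1 y + scale t (bracket z y))"
      by (simp add: bracket_bilinear fun_eq_iff)
    then show "dim (range (\<lambda>y. bracket x1 y + scale t (bracket z y))) \<le> dim (range (bracket x1))"
      using rank_le[of "x1 + scale t z"] range_ad_x1(2) by simp
  next
    fix t :: 'k
    assume "t \<noteq> 0"
    from assms[OF this] show "w \<in> range (\<lambda>y. bracket x1 y + scale t (bracket z y))" by blast
  qed
qed

text \<open>First-order condition: \<open>ad (x1 + t z)\<close> maps \<open>y / t\<close> to \<open>[z,y]\<close>.\<close>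

lemma bracket_kernel_in_range:
  assumes "bracket x1 y = 0"
  shows "bracket z y \<in> range (bracket x1)"
proof (rule in_range_of_pencil)
  fix t :: 'k
  assume "t \<noteq> 0"
  then have "bracket x1 (scale (inverse t) y) + scale t (bracket z (scale (inverse t) y)) = bracket z y"
    using assms by (simp add: bracket_bilinear)
  then show "\<exists>u. bracket x1 u + scale t (bracket z u) = bracket z y" by blast
qed

text \<open>Second-order condition: \<open>ad (x1 + t z)\<close> maps \<open>t u - y\<close> to \<open>t^2 [z,u]\<close>, since the terms of first
  order in \<open>t\<close> cancel.\<close>

lemma bracket_preimage_in_range:
  assumes "bracket x1 y = 0" "bracket z y = bracket x1 u"
  shows "bracket z u \<in> range (bracket x1)"
proof (rule in_range_of_pencil)
  fix t :: 'k
  assume t: "t \<noteq> 0"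
  let ?c = "inverse t * inverse t"
  have c: "?c * (t * t) = 1" using t by (simp add: mult.assoc flip: mult.assoc[of "inverse t" t])
  have "bracket x1 (scale t u - y) + scale t (bracket z (scale t u - y)) = scale (t * t) (bracket z u)"
    using assms by (simp add: bracket_bilinear algebra_simps)
  then have "scale ?c (bracket x1 (scale t u - y) + scale t (bracket z (scale t u - y))) = bracket z u"
    by (simp only: scale_scale c scale_one)
  then have "bracket x1 (scale ?c (scale t u - y)) + scale t (bracket z (scale ?c (scale t u - y)))
      = bracket z u"
    by (simp only: bracket_scale_right scale_right_distrib scale_left_commute[of t])
  then show "\<exists>v. bracket x1 v + scale t (bracket z v) = bracket z u" by blast
qed

lemma ad_eigenvalue_0:
  assumes "bracket z v = scale c v" "v \<noteq> 0"
  shows "c = 0"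
proof -
  obtain m where "\<And>x y. (bracket x ^^ m) y = 0" using ad_nil by blast
  then have m: "(bracket z ^^ m) v = 0" .
  show ?thesis
    by (rule nilpotent_eigenvalue_mod_subspace[OF linear_bracket_right subspace_single_0 _ m])
      (use assms in \<open>auto simp: bracket_zero\<close>)
qed

text \<open>Only the first equation uses the rank. The others arise from it by applying \<open>ad x1\<close>, which is a
  derivation that kills \<open>y\<close> and shifts the orbit.\<close>

lemma kernel_brackets:
  assumes "bracket x1 y = 0"
  obtains a b c where "bracket x2 y = scale a x3 + scale b x4 + scale c x5"
    "bracket x3 y = scale a x4 + scale b x5" "bracket x4 y = scale a x5" "bracket x5 y = 0"
proof -
  obtain a b c where 2: "bracket x2 y = scale a x3 + scale b x4 + scale c x5"
    using bracket_kernel_in_range[OF assms, of x2] in_range_ad_x1 by blast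
  have "bracket x1 (bracket u y) = bracket (bracket x1 u) y" for u
    using bracket_derivation[of x1 u y] assms by (simp add: bracket_zero)
  note shift = this[symmetric]
  have 3: "bracket x3 y = scale a x4 + scale b x5"
    using shift[of x2] by (simp add: orbit_simps 2 bracket_bilinear bracket_x1_x5)
  have 4: "bracket x4 y = scale a x5"
    using shift[of x3] by (simp add: orbit_simps 3 bracket_bilinear bracket_x1_x5)
  have 5: "bracket x5 y = 0"
    using shift[of x4] by (simp add: orbit_simps 4 bracket_bilinear bracket_x1_x5)
  show thesis using 2 3 4 5 by (rule that)
qed

text \<open>If the coefficients of \<open>[x2,x5]\<close> did not vanish, \<open>x5\<close> would be an eigenvector, with nonzero
  eigenvalue, of one of \<open>ad x4\<close>, \<open>ad x3\<close>, \<open>ad x2\<close>.\<close>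

lemma x5_central_orbit: "bracket x2 x5 = 0" "bracket x3 x5 = 0" "bracket x4 x5 = 0"
proof -
  obtain a b c where br: "bracket x2 x5 = scale a x3 + scale b x4 + scale c x5"
    "bracket x3 x5 = scale a x4 + scale b x5" "bracket x4 x5 = scale a x5"
    by (rule kernel_brackets[OF bracket_x1_x5])
  have "a = 0" using ad_eigenvalue_0[OF br(3) x5_nonzero] .
  moreover from this have "b = 0" using ad_eigenvalue_0[of x3 x5 b] br(2) x5_nonzero by simp
  moreover from calculation have "c = 0" using ad_eigenvalue_0[of x2 x5 c] br(1) x5_nonzero by simp
  ultimately show "bracket x2 x5 = 0" "bracket x3 x5 = 0" "bracket x4 x5 = 0"
    using br by simp_all
qed

text \<open>The span of the basis vectors from the fifth on. The kernel of \<open>ad x1\<close> also contains \<open>x1\<close>; the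
  second condition selects a complement of the line through \<open>x1\<close> in that kernel.\<close>

definition "tail_space = {y. bracket x1 y = 0 \<and> bracket x2 y \<in> span {x4, x5}}"

lemma subspace_tail: "subspace tail_space"
  by (rule subspaceI) (auto simp: tail_space_def bracket_bilinear span_zero intro: span_add span_scale)

text \<open>Here the coefficient of \<open>x3\<close> in \<open>[x2,y]\<close> is zero, hence so are the coefficients that
  \<open>kernel_brackets\<close> derives from it.\<close>

lemma tail_brackets:
  assumes "y \<in> tail_space"
  obtains b c where "bracket x2 y = scale b x4 + scale c x5" "bracket x3 y = scale b x5"
    "bracket x4 y = 0" "bracket x5 y = 0"
proof -
  have y: "bracket x1 y = 0" and y2: "bracket x2 y \<in> span {x4, x5}"
    using assms by (simp_all add: tail_space_def)
  obtain a b c where br: "bracket x2 y = scale a x3 + scale b x4 + scale c x5"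
    "bracket x3 y = scale a x4 + scale b x5" "bracket x4 y = scale a x5" "bracket x5 y = 0"
    by (rule kernel_brackets[OF y])
  have "scale b x4 + scale c x5 \<in> span {x4, x5}" by (auto simp: in_span_x4_x5)
  from span_diff[OF y2 this] have "scale a x3 \<in> span {x4, x5}" by (simp add: br(1))
  then have "scale (inverse a) (scale a x3) \<in> span {x4, x5}" by (rule span_scale)
  with x3_notin have "a = 0" by (cases "a = 0") simp_all
  with br show thesis by (intro that[of b c]) simp_all
qed

lemma x5_in_tail: "x5 \<in> tail_space"
  by (simp add: tail_space_def bracket_x1_x5 x5_central_orbit span_zero)

text \<open>A combination of \<open>x2\<close>, \<open>x3\<close>, \<open>x4\<close> has the same image under \<open>ad x1\<close> as \<open>v\<close>; the difference lies in
  the kernel, and a multiple of \<open>x1\<close>, for which \<open>[x2,x1] = - x3\<close>, moves it into \<open>tail_space\<close>.\<close>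

lemma decomposition:
  obtains s p q r y where "y \<in> tail_space" "v = scale s x1 + scale p x2 + scale q x3 + scale r x4 + y"
proof -
  obtain p q r where pqr: "bracket x1 v = scale p x3 + scale q x4 + scale r x5"
    using in_range_ad_x1 by blast
  define z where "z = v - (scale p x2 + scale q x3 + scale r x4)"
  have z: "bracket x1 z = 0" by (simp add: z_def bracket_bilinear pqr orbit_simps)
  obtain a b c where 2: "bracket x2 z = scale a x3 + scale b x4 + scale c x5"
    by (rule kernel_brackets[OF z])
  have "bracket x2 (z + scale a x1) = scale b x4 + scale c x5"
    using bracket_antisym[of x2 x1] by (simp add: bracket_bilinear 2 orbit_simps)
  then have "z + scale a x1 \<in> tail_space"
    using z by (auto simp: tail_space_def bracket_bilinear bracket_self in_span_x4_x5)
  moreover have "v = scale (- a) x1 + scale p x2 + scale q x3 + scale r x4 + (z + scale a x1)"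
    by (simp add: z_def)
  ultimately show thesis by (rule that)
qed

lemma range_inter_kernel:
  assumes "v \<in> range (bracket x1)" "bracket x1 v = 0"
  shows "v \<in> span {x5}"
proof -
  obtain a b c where v: "v = scale a x3 + scale b x4 + scale c x5"
    using assms(1) in_range_ad_x1 by blast
  then have 1: "scale a x4 + scale b x5 = 0"
    using assms(2) by (simp add: bracket_bilinear orbit_simps bracket_x1_x5)
  from arg_cong[OF this, of "bracket x1"] have "a = 0"
    using x5_nonzero by (simp add: bracket_bilinear orbit_simps bracket_x1_x5)
  with 1 have "b = 0" using x5_nonzero by simp
  with \<open>a = 0\<close> v show ?thesis by (auto simp: in_span_x5)
qed

lemma bracket_tail_tail:
  assumes "y \<in> tail_space" "z \<in> tail_space"
  shows "bracket y z \<in> span {x5}"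
proof (rule range_inter_kernel)
  show "bracket y z \<in> range (bracket x1)"
    using assms by (intro bracket_kernel_in_range) (simp add: tail_space_def)
  show "bracket x1 (bracket y z) = 0"
    using assms bracket_derivation[of x1 y z] by (simp add: tail_space_def bracket_zero)
qed

text \<open>Decompose \<open>[x2,x3]\<close> along \<open>x1\<close>, \<open>x2\<close>, \<open>x3\<close>, \<open>x4\<close> with coefficients \<open>s\<close>, \<open>p\<close>, \<open>q\<close>, \<open>r\<close>. Applying \<open>ad x1\<close>
  three times gives \<open>p x5 = [x4,x4] + [x3,x5] = 0\<close>. Then \<open>q\<close> is the eigenvalue of \<open>ad x2\<close> on \<open>x4\<close> modulo \<open>x5\<close>, and
  \<open>- s\<close> is the eigenvalue of \<open>(ad x2)^2\<close> on \<open>x3\<close> modulo \<open>x4\<close> and \<open>x5\<close>; both vanish by nilpotency.\<close>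

lemma bracket_x2_x3:
  obtains r y where "y \<in> tail_space" "bracket x2 x3 = scale r x4 + y"
proof -
  obtain m where m: "\<And>x y. (bracket x ^^ m) y = 0" using ad_nil by blast
  obtain s p q r y where y: "y \<in> tail_space"
    and W: "bracket x2 x3 = scale s x1 + scale p x2 + scale q x3 + scale r x4 + y"
    by (rule decomposition)
  have y1: "bracket x1 y = 0" using y by (simp add: tail_space_def)
  have TW: "bracket x2 x4 = bracket x1 (bracket x2 x3)"
    "bracket x3 x4 = bracket x1 (bracket x2 x4)" "bracket x1 (bracket x3 x4) = 0"
    using bracket_derivation[of x1] by (simp_all add: orbit_simps bracket_self x5_central_orbit)
  have 24: "bracket x2 x4 = scale p x3 + scale q x4 + scale r x5"
    by (simp add: TW(1) W bracket_bilinear orbit_simps y1 bracket_self)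
  have 34: "bracket x3 x4 = scale p x4 + scale q x5"
    by (simp add: TW(2) 24 bracket_bilinear orbit_simps bracket_x1_x5)
  have "p = 0"
    using TW(3) x5_nonzero by (simp add: 34 bracket_bilinear orbit_simps bracket_x1_x5)
  have inv5: "bracket x2 v \<in> span {x5}" if "v \<in> span {x5}" for v
    using that by (auto simp: in_span_x5 bracket_bilinear x5_central_orbit intro: exI[of _ 0])
  have "q = 0"
  proof (rule nilpotent_eigenvalue_mod_subspace[OF linear_bracket_right subspace_span inv5 m])
    show "bracket x2 x4 - scale q x4 \<in> span {x5}" by (auto simp: 24 \<open>p = 0\<close> in_span_x5)
  qed (simp_all add: x4_notin)
  let ?S = "\<lambda>v. bracket x2 (bracket x2 v)"
  have lin: "Vector_Spaces.linear scale scale ?S"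
    using Vector_Spaces.linear_compose[OF linear_bracket_right linear_bracket_right, of x2 x2]
    by (simp add: comp_def)
  have inv45: "?S v \<in> span {x4, x5}" if "v \<in> span {x4, x5}" for v
    using that by (auto simp: in_span_x4_x5 bracket_bilinear x5_central_orbit 24 \<open>p = 0\<close> \<open>q = 0\<close>
        intro: exI[of _ 0])
  have "(?S ^^ k) v = (bracket x2 ^^ (k + k)) v" for k v
    by (induction k) simp_all
  then have nil: "(?S ^^ m) v = 0" for v using m by (simp add: funpow_add)
  have "- s = 0"
  proof (rule nilpotent_eigenvalue_mod_subspace[OF lin subspace_span inv45 nil])
    have "bracket x2 y \<in> span {x4, x5}" using y by (simp add: tail_space_def)
    moreover have "?S x3 - scale (- s) x3 = scale (r * r) x5 + bracket x2 y"
      using bracket_antisym[of x2 x1]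
      by (simp add: W \<open>p = 0\<close> \<open>q = 0\<close> bracket_bilinear 24 orbit_simps)
    ultimately show "?S x3 - scale (- s) x3 \<in> span {x4, x5}"
      by (simp add: span_add span_scale span_base)
  qed (simp_all add: x3_notin)
  with \<open>p = 0\<close> \<open>q = 0\<close> W y that[of y r] show thesis by simp
qed

text \<open>The powers of \<open>ad x1\<close> isolate \<open>p\<close>, \<open>q\<close> and \<open>r\<close> in turn. They do not see \<open>x1\<close>, which is outside \<open>tail_space\<close>
  because \<open>[x2,x1] = - x3\<close> is not in the span of \<open>x4\<close> and \<open>x5\<close>.\<close>

lemma independent_mod_tail:
  assumes "scale s x1 + scale p x2 + scale q x3 + scale r x4 \<in> tail_space" (is "?v \<in> tail_space")
  shows "s = 0 \<and> p = 0 \<and> q = 0 \<and> r = 0"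
proof -
  have T: "scale p x3 + scale q x4 + scale r x5 = 0"
    using assms by (simp add: tail_space_def bracket_bilinear bracket_self orbit_simps)
  from arg_cong[OF this, of "\<lambda>v. bracket x1 (bracket x1 v)"] have "p = 0"
    using x5_nonzero by (simp add: bracket_bilinear orbit_simps bracket_x1_x5)
  moreover from this arg_cong[OF T, of "bracket x1"] have "q = 0"
    using x5_nonzero by (simp add: bracket_bilinear orbit_simps bracket_x1_x5)
  moreover from calculation T have "r = 0" using x5_nonzero by simp
  moreover have "s = 0"
  proof (rule ccontr)
    assume "s \<noteq> 0"
    have "bracket x2 (scale s x1) = - scale s x3"
      using bracket_antisym[of x2 x1] by (simp add: bracket_bilinear orbit_simps)
    then have "- scale s x3 \<in> span {x4, x5}"
      using assms \<open>p = 0\<close> \<open>q = 0\<close> \<open>r = 0\<close> by (simp add: tail_space_def)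
    then have "scale (- inverse s) (- scale s x3) \<in> span {x4, x5}" by (rule span_scale)
    then show False using x3_notin \<open>s \<noteq> 0\<close> by simp
  qed
  ultimately show ?thesis by blast
qed

text \<open>A basis of \<open>tail_space\<close> containing \<open>x5\<close>, together with \<open>x1\<close>, ..., \<open>x4\<close>.\<close>

lemma adapted_basis:
  obtains X where "basis_family (dim (UNIV :: 'v set)) X"
    "X 1 = x1" "X 2 = x2" "X 3 = x3" "X 4 = x4" "X 5 = x5"
    "X ` {6..dim (UNIV :: 'v set)} \<subseteq> tail_space" "tail_space \<subseteq> span (insert x5 (X ` {6..dim (UNIV :: 'v set)}))"
proof -
  let ?n = "dim (UNIV :: 'v set)"
  obtain Basis where "finite_dimensional_vector_space scale Basis" by (rule finite_basis)
  then interpret fd: finite_dimensional_vector_space scale Basis .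
  have "{x5} \<subseteq> tail_space" "independent {x5}" using x5_in_tail x5_nonzero by auto
  then obtain B where B: "{x5} \<subseteq> B" "B \<subseteq> tail_space" "independent B" "tail_space \<subseteq> span B"
    using maximal_independent_subset_extend by metis
  have spB: "span B \<subseteq> tail_space" using B(2) subspace_tail by (rule span_minimal)
  have finB: "finite B" using B(3) by (rule fd.finiteI_independent)
  have x4: "x4 \<notin> span B" 
    using independent_mod_tail[of 0 0 0 1] spB by auto
  have x3: "x3 \<notin> span (insert x4 B)"
  proof
    assume "x3 \<in> span (insert x4 B)"
    then obtain r where "x3 - scale r x4 \<in> tail_space" using spB by (auto simp: span_breakdown_eq)
    then show False using independent_mod_tail[of 0 0 1 "- r"] by simp
  qed
  have x2: "x2 \<notin> span (insert x3 (insert x4 B))"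
  proof
    assume "x2 \<in> span (insert x3 (insert x4 B))"
    then obtain q r where "x2 - scale q x3 - scale r x4 \<in> tail_space"
      using spB by (auto simp: span_breakdown_eq)
    then show False using independent_mod_tail[of 0 1 "- q" "- r"] by simp
  qed
  have x1: "x1 \<notin> span (insert x2 (insert x3 (insert x4 B)))"
  proof
    assume "x1 \<in> span (insert x2 (insert x3 (insert x4 B)))"
    then obtain p q r where "x1 - scale p x2 - scale q x3 - scale r x4 \<in> tail_space"
      using spB by (auto simp: span_breakdown_eq)
    then show False using independent_mod_tail[of 1 "- p" "- q" "- r"] by simp
  qed
  let ?S = "insert x1 (insert x2 (insert x3 (insert x4 B)))"
  have ind: "independent ?S"
    using x1 x2 x3 x4 B(3) by (intro independent_insertI)
  have "v \<in> span ?S" for v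
  proof -
    obtain s p q r y where y: "y \<in> tail_space" and v: "v = scale s x1 + scale p x2 + scale q x3 + scale r x4 + y"
      by (rule decomposition)
    have "span B \<subseteq> span ?S" by (rule span_mono) auto
    then have "y \<in> span ?S" using y B(4) by blast
    then show ?thesis unfolding v by (intro span_add span_scale) (simp_all add: span_base)
  qed
  then have sp: "span ?S = UNIV" by blast
  have card: "card ?S = ?n" using dim_span_eq_card_independent[OF ind] unfolding sp by simp
  have notin: "x \<notin> A" if "x \<notin> span A" for x A
    using that by (rule contrapos_nn) (rule span_base)
  have "card ?S = Suc (Suc (Suc (Suc (card B))))"
    using finB by (simp only: card_insert_disjoint notin[OF x1] notin[OF x2] notin[OF x3] notin[OF x4] finite_insert not_False_eq_True)
  moreover have "card (B - {x5}) = card B - 1" "card B \<noteq> 0"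
    using B(1) finB by (auto simp: card_Diff_singleton)
  ultimately have "card {6..?n} = card (B - {x5})" "?n \<ge> 5" using card by auto
  then obtain h where h: "bij_betw h {6..?n} (B - {x5})"
    using finite_same_card_bij[of "{6..?n}" "B - {x5}"] finB by auto
  define X where "X i = (if i = 1 then x1 else if i = 2 then x2 else if i = 3 then x3
    else if i = 4 then x4 else if i = 5 then x5 else h i)" for i :: nat
  have hX: "X ` {6..?n} = B - {x5}"
    using h by (auto simp: bij_betw_def X_def)
  have "{1..?n} = {1, 2, 3, 4, 5} \<union> {6..?n}" using \<open>?n \<ge> 5\<close> by auto
  then have "X ` {1..?n} = {x1, x2, x3, x4, x5} \<union> (B - {x5})"
    by (simp only: image_Un hX) (auto simp: X_def)
  then have img: "X ` {1..?n} = ?S" using B(1) by auto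
  then have "inj_on X {1..?n}" using card by (intro eq_card_imp_inj_on) auto
  then have "basis_family ?n X" using ind sp img by (simp add: basis_family_def)
  moreover have "X ` {6..?n} \<subseteq> tail_space" using hX B(2) by blast
  moreover have "insert x5 (X ` {6..?n}) = B" using hX B(1) by blast
  ultimately show thesis using B(4) by (intro that[of X]) (auto simp: X_def)
qed

end

locale normalized_breadth_3_pair = breadth_3_pair scale bracket x1 x2
  for scale :: "'k::field \<Rightarrow> 'v::ab_group_add \<Rightarrow> 'v" and bracket x1 x2 +
  assumes x2_x3_in_tail: "bracket x2 x3 \<in> tail_space"
begin

lemma x4_brackets: "bracket x2 x4 = 0" "bracket x3 x4 = 0"
proof -
  have "bracket x2 x4 = bracket x1 (bracket x2 x3)" "bracket x3 x4 = bracket x1 (bracket x2 x4)"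
    using bracket_derivation[of x1] by (simp_all add: orbit_simps bracket_self x5_central_orbit)
  then show "bracket x2 x4 = 0" "bracket x3 x4 = 0"
    using x2_x3_in_tail by (simp_all add: tail_space_def bracket_zero)
qed

text \<open>The Jacobi identity for \<open>x2\<close>, \<open>x3\<close>, \<open>y\<close>, in which the other two terms vanish.\<close>

lemma x2_x3_centralizes_tail:
  assumes "y \<in> tail_space"
  shows "bracket (bracket x2 x3) y = 0"
proof -
  obtain b c where y: "bracket x2 y = scale b x4 + scale c x5" "bracket x3 y = scale b x5"
    by (rule tail_brackets[OF assms])
  have "bracket x2 (bracket x3 y) = 0" "bracket x3 (bracket x2 y) = 0"
    by (simp_all add: y bracket_bilinear x4_brackets x5_central_orbit)
  then show ?thesis using bracket_derivation[of x2 x3 y] by simp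
qed

text \<open>The second-order condition for \<open>z = x2\<close>: the bracket \<open>[x2,y] = b x4 + c x5\<close> has the preimage
  \<open>b x3 + c x4\<close>, on which \<open>ad x2\<close> takes the value \<open>b [x2,x3]\<close>. This value also commutes with \<open>x1\<close>, and
  the range and the kernel of \<open>ad x1\<close> meet only in the multiples of \<open>x5\<close>.\<close>

lemma dichotomy: "(\<forall>y\<in>tail_space. bracket x2 y \<in> span {x5}) \<or> bracket x2 x3 \<in> span {x5}"
proof (rule disjCI, rule ballI)
  fix y
  assume W: "bracket x2 x3 \<notin> span {x5}" and y: "y \<in> tail_space"
  obtain b c where 2: "bracket x2 y = scale b x4 + scale c x5" by (rule tail_brackets[OF y])
  then have "bracket x2 y = bracket x1 (scale b x3 + scale c x4)"
    by (simp add: bracket_bilinear orbit_simps)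
  moreover have "bracket x1 y = 0" using y by (simp add: tail_space_def)
  ultimately have "bracket x2 (scale b x3 + scale c x4) \<in> range (bracket x1)"
    using bracket_preimage_in_range by blast
  then have "scale b (bracket x2 x3) \<in> range (bracket x1)"
    by (simp add: bracket_bilinear x4_brackets)
  moreover have "bracket x1 (bracket x2 x3) = 0" using x2_x3_in_tail by (simp add: tail_space_def)
  ultimately have "scale b (bracket x2 x3) \<in> span {x5}"
    by (intro range_inter_kernel) (simp_all add: bracket_bilinear)
  then have "scale (inverse b) (scale b (bracket x2 x3)) \<in> span {x5}" by (rule span_scale)
  with W have "b = 0" by (cases "b = 0") simp_all
  then show "bracket x2 y \<in> span {x5}" by (auto simp: 2 in_span_x5)
qed

lemma multiplication_table:
  obtains X where "basis_family (dim (UNIV :: 'v set)) X"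
    "first_family (dim (UNIV :: 'v set)) X \<or> second_family (dim (UNIV :: 'v set)) X"
proof -
  let ?n = "dim (UNIV :: 'v set)"
  obtain X where basis: "basis_family ?n X"
    and X15: "X 1 = x1" "X 2 = x2" "X 3 = x3" "X 4 = x4" "X 5 = x5"
    and XK: "X ` {6..?n} \<subseteq> tail_space" and spK: "tail_space \<subseteq> span (insert x5 (X ` {6..?n}))"
    by (rule adapted_basis)
  have inj: "inj_on X {6..?n}"
    using basis by (auto simp: basis_family_def intro: inj_on_subset)
  have tail_space: "X k \<in> tail_space" if "6 \<le> k" "k \<le> ?n" for k using XK that by auto
  have "\<exists>b c. bracket x2 (X k) = scale b x4 + scale c x5 \<and> bracket x3 (X k) = scale b x5"
    if "6 \<le> k" "k \<le> ?n" for k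
    using tail_brackets[OF tail_space[OF that]] by metis
  then obtain \<alpha> \<beta> where x2X: "bracket x2 (X k) = scale (\<alpha> k) x4 + scale (\<beta> k) x5"
    and x3X: "bracket x3 (X k) = scale (\<alpha> k) x5" if "6 \<le> k" "k \<le> ?n" for k
    by metis
  have x1X: "bracket x1 (X k) = 0" and x4X: "bracket x4 (X k) = 0"
    and x5X: "bracket x5 (X k) = 0" if "6 \<le> k" "k \<le> ?n" for k
    using tail_brackets[OF tail_space[OF that]] tail_space[OF that] by (auto simp: tail_space_def)
  define c where "c i j = (SOME c. bracket (X i) (X j) = scale c x5)" for i j
  have c: "bracket (X i) (X j) = scale (c i j) x5" if "6 \<le> i" "i \<le> ?n" "6 \<le> j" "j \<le> ?n" for i j
    unfolding c_def
    by (rule someI_ex) (use bracket_tail_tail[OF tail_space tail_space, OF that] in \<open>simp add: in_span_x5\<close>)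
  obtain a d where W: "bracket x2 x3 = scale a x5 + (\<Sum>k = 6..?n. scale (d k) (X k))"
  proof -
    have "bracket x2 x3 \<in> span (insert x5 (X ` {6..?n}))" using x2_x3_in_tail spK by blast
    then obtain a where "bracket x2 x3 - scale a x5 \<in> span (X ` {6..?n})"
      unfolding span_breakdown_eq by blast
    then obtain u where "bracket x2 x3 - scale a x5 = (\<Sum>v\<in>X ` {6..?n}. scale (u v) v)"
      using span_finite[of "X ` {6..?n}"] by auto
    then have "bracket x2 x3 = scale a x5 + (\<Sum>k = 6..?n. scale (u (X k)) (X k))"
      by (simp add: sum.reindex[OF inj] diff_eq_eq add.commute)
    then show thesis by (rule that)
  qed
  have split: "i \<in> {1, 2, 3, 4, 5} \<or> 6 \<le> i" "j \<in> {2, 3, 4, 5} \<or> 6 \<le> j"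
    if "1 \<le> i \<and> i < j \<and> j \<le> ?n" for i j
    using that by auto
  note table = X15(1)[unfolded One_nat_def] X15(2-5) orbit_simps bracket_x1_x5 x4_brackets x5_central_orbit x1X x2X x3X x4X x5X c
  from dichotomy show thesis
  proof
    assume small: "\<forall>y\<in>tail_space. bracket x2 y \<in> span {x5}"
    \<comment> \<open>apply \<open>ad x1\<close> to isolate the coefficient of \<open>x4\<close>\<close>
    have \<alpha>: "\<alpha> k = 0" if k: "6 \<le> k" "k \<le> ?n" for k
    proof -
      obtain e where "bracket x2 (X k) = scale e x5"
        using small tail_space[OF k] by (auto simp: in_span_x5)
      then have "scale (\<alpha> k) x4 + scale (\<beta> k) x5 = scale e x5" using x2X[OF k] by simp
      from arg_cong[OF this, of "bracket x1"] show ?thesis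
        using x5_nonzero by (simp add: bracket_bilinear orbit_simps bracket_x1_x5)
    qed
    have "bracket (X i) (X j) =
            (if i = 1 \<and> j \<in> {2, 3, 4} then X (j + 1)
             else if i = 2 \<and> j = 3 then scale a (X 5) + (\<Sum>k = 6..?n. scale (d k) (X k))
             else if i = 2 \<and> 6 \<le> j then scale (\<beta> j) (X 5)
             else if 6 \<le> i then scale (c i j) (X 5)
             else 0)" if ij: "1 \<le> i \<and> i < j \<and> j \<le> ?n" for i j
      using split[OF ij] ij by (auto simp: table W \<alpha>)
    moreover have "(\<Sum>i = 6..j - 1. c i j * d i) - (\<Sum>i = j + 1..?n. c j i * d i) = 0"
      if j: "6 \<le> j \<and> j \<le> ?n" for j
    proof -
      have skew: "c k j = - c j k" if "6 \<le> k" "k \<le> ?n" for k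
      proof -
        have "scale (c k j) x5 = - scale (c j k) x5"
          using bracket_antisym[of "X k" "X j"] c[of k j] c[of j k] j that by simp
        then have "scale (c k j) x5 = scale (- c j k) x5" by simp
        then show ?thesis using x5_nonzero by (simp only: scale_cancel_right) simp
      qed
      have "c j j = 0"
        using c[of j j] j bracket_self[of "X j"] x5_nonzero by simp
      \<comment> \<open>the coefficient of \<open>x5\<close> in \<open>[[x2,x3], X j] = 0\<close> is the condition to be shown\<close>
      have "0 = bracket (bracket x2 x3) (X j)"
        using x2_x3_centralizes_tail tail_space j by simp
      also have "\<dots> = (\<Sum>k = 6..?n. scale (c k j * d k) x5)"
        unfolding W bracket_add_left bracket_sum_left using j
        by (simp add: bracket_bilinear x5X c mult.commute)
      finally have "scale (\<Sum>k = 6..?n. c k j * d k) x5 = 0"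
        by (simp add: scale_sum_left)
      then have "0 = (\<Sum>k = 6..?n. c k j * d k)" using x5_nonzero by simp
      also have "{6..?n} = {6..j - 1} \<union> insert j {j + 1..?n}" using j by auto
      also have "(\<Sum>k\<in>\<dots>. c k j * d k)
          = (\<Sum>k = 6..j - 1. c k j * d k) + (c j j * d j + (\<Sum>k = j + 1..?n. c k j * d k))"
        by (subst sum.union_disjoint) auto
      also have "(\<Sum>k = j + 1..?n. c k j * d k) = - (\<Sum>k = j + 1..?n. c j k * d k)"
        unfolding sum_negf[symmetric] using j by (intro sum.cong) (auto simp: skew)
      finally show ?thesis by (simp add: \<open>c j j = 0\<close>)
    qed
    ultimately have "second_family ?n X" unfolding second_family_def by blast
    with basis that show thesis by blast
  next
    assume "bracket x2 x3 \<in> span {x5}"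
    then obtain a where W: "bracket x2 x3 = scale a x5" by (auto simp: in_span_x5)
    have "bracket (X i) (X j) =
            (if i = 1 \<and> j \<in> {2, 3, 4} then X (j + 1)
             else if i = 2 \<and> j = 3 then scale a (X 5)
             else if i = 2 \<and> 6 \<le> j then scale (\<alpha> j) (X 4) + scale (\<beta> j) (X 5)
             else if i = 3 \<and> 6 \<le> j then scale (\<alpha> j) (X 5)
             else if 6 \<le> i then scale (c i j) (X 5)
             else 0)" if ij: "1 \<le> i \<and> i < j \<and> j \<le> ?n" for i j
      using split[OF ij] ij by (auto simp: table W)
    then have "first_family ?n X" unfolding first_family_def by blast
    with basis that show thesis by blast
  qed
qed

end

context breadth_3_pair
begin

text \<open>Replacing \<open>x2\<close> by \<open>x2 - r x1\<close> changes neither the rest of the orbit nor \<open>tail_space\<close>, and subtracts \<open>r x4\<close>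
  from \<open>[x2,x3]\<close>.\<close>

lemma normalization:
  obtains r where "normalized_breadth_3_pair scale bracket x1 (x2 - scale r x1)"
proof -
  obtain r y where y: "y \<in> tail_space" "bracket x2 x3 = scale r x4 + y" by (rule bracket_x2_x3)
  let ?x2 = "x2 - scale r x1"
  have same: "bracket x1 ?x2 = bracket x1 x2"
    by (simp add: bracket_bilinear bracket_self)
  interpret P: breadth_3_pair scale bracket x1 ?x2
    using infinite_field ad_nil rank_le long_orbit[folded same] by unfold_locales
  have P: "P.x3 = x3" "P.x4 = x4" "P.x5 = x5"
    by (simp_all only: P.x3_def P.x4_def P.x5_def x3_def x4_def x5_def same)
  have "P.tail_space = tail_space"
    unfolding P.tail_space_def tail_space_def P by (auto simp: bracket_bilinear)
  moreover have "bracket ?x2 x3 = y"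
    by (simp add: y(2) bracket_bilinear orbit_simps)
  ultimately have "normalized_breadth_3_pair scale bracket x1 ?x2"
    using y(1) by unfold_locales (simp add: P)
  then show thesis by (rule that)
qed

end

section \<open>The classification\<close>

theorem proposition8:
  fixes scale :: "'k::field_char_0 \<Rightarrow> 'v::ab_group_add \<Rightarrow> 'v"
    and bracket :: "'v \<Rightarrow> 'v \<Rightarrow> 'v"
    and n :: nat
  assumes "finite_dimensional_lie_algebra scale bracket"
    and "n \<ge> 5"
    and "vector_space.dim scale (UNIV :: 'v set) = n"
    and "lie_algebra.nilpotent scale bracket"
    and "lie_algebra.breadth scale bracket = 3"
    and "lie_algebra.characteristic_sequence scale bracket = 4 # replicate (n - 4) 1"
  shows "\<exists>(bracket' :: 'v \<Rightarrow> 'v \<Rightarrow> 'v) X.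
           lie_algebra scale bracket' \<and>
           lie_isomorphic scale bracket scale bracket' \<and>
           lie_algebra.basis_family scale n X \<and>
           (lie_algebra.first_family scale bracket' n X \<or>
            lie_algebra.second_family scale bracket' n X)"
proof -
  interpret finite_dimensional_lie_algebra scale bracket by (rule assms(1))
  have nontrivial: "(UNIV :: 'v set) \<noteq> {0}"
  proof
    assume "(UNIV :: 'v set) = {0}"
    moreover have "dim {0::'v} \<le> card ({} :: 'v set)" by (intro dim_le_card) auto
    ultimately show False using assms(2,3) by simp
  qed
  obtain x1 where type: "jordan_block_dims (bracket x1) (4 # replicate (n - 4) 1)"
    using characteristic_sequence_attained[OF assms(4) nontrivial] assms(6) by auto
  \<comment> \<open>a Jordan block of size 4 prevents the cube from vanishing\<close>
  have "\<not> (\<forall>y. (bracket x1 ^^ 3) y = 0)"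
  proof
    assume "\<forall>y. (bracket x1 ^^ 3) y = 0"
    then have "(4 :: nat) \<le> 3"
      by (intro jordan_block_dims_le_nilpotency_index[OF linear_bracket_right _ type]) auto
    then show False by simp
  qed
  then obtain x2 where long: "bracket x1 (bracket x1 (bracket x1 x2)) \<noteq> 0"
    by (auto simp: numeral_3_eq_3)
  have nil: "\<exists>m. \<forall>x y. (bracket x ^^ m) y = 0"
    by (rule ad_nilpotent[OF assms(4)]) blast
  interpret P: breadth_3_pair scale bracket x1 x2
    using infinite_UNIV_char_0 nil rank_le_breadth[unfolded assms(5)] long by unfold_locales
  obtain r where "normalized_breadth_3_pair scale bracket x1 (x2 - scale r x1)"
    by (rule P.normalization)
  then interpret N: normalized_breadth_3_pair scale bracket x1 "x2 - scale r x1" .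
  obtain X where "basis_family n X" "first_family n X \<or> second_family n X"
    using N.multiplication_table unfolding assms(3) by blast
  moreover have "lie_isomorphic scale bracket scale bracket"
    unfolding lie_isomorphic_def using linear_id bij_id by (intro exI[of _ id]) simp
  ultimately show ?thesis using lie_algebra_axioms by blast
qed

end
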